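(* Let $A$ be an $LC^*$-algebra. A $C^*$-seminorm $p$ on $A$ is lower semicontinuous if and only if $$X_p^*(A)=\operatorname{cl}_{X^*(A)}\bigl[X_p^*(A)\cap X_c^*(A)\bigr].$$
   Context: "Algebra" means commutative associative algebra over $\mathbb{C}$ with unit. An involutive algebra is an algebra with a conjugate-linear map $x\mapsto x^*$ satisfying $(x^* )^*=x$, $(xy)^*=y^*x^*$. A hermitian character is a unit-preserving algebra homomorphism $\chi\colon A\to\mathbb{C}$ with $\chi(x^* )=\overline{\chi(x)}$. A $C^*$-seminorm on $A$ is a seminorm $p$ with $p(xx^* )=p(x)^2$ for all $x$. An $LC^*$-algebra is an involutive algebra with a topology defined by a family of $C^*$-seminorms (not necessarily Hausdorff). $X^*(A)$ is the set of all hermitian characters of $A$ with the topology of pointwise convergence on $A$; $X_c^*(A)\subset X^*(A)$ is the subset of characters continuous for the topology of $A$; $X_p^*(A)\subset X^*(A)$ is the subset of characters continuous for the topology defined by the single seminorm $p$. $\operatorname{cl}_{X^*(A)}$ denotes closure in $X^*(A)$. Lower semicontinuity of $p$ is with respect to the topology of $A$. *)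

theory Defs
  imports "HOL-Analysis.Analysis"
begin

text \<open>
  The sort used below describes commutative associative rings with unit; unlike
  \<^class>\<open>comm_ring_1\<close> it does not demand \<open>0 \<noteq> 1\<close>, so the zero algebra is included.
\<close>

locale involutive_algebra =
  vector_space scaleC
  for scaleC :: "complex \<Rightarrow> 'a::{comm_ring, comm_monoid_mult} \<Rightarrow> 'a" +
  fixes star :: "'a \<Rightarrow> 'a"
  assumes scaleC_mult_left: "scaleC c x * y = scaleC c (x * y)"
    and star_add: "star (x + y) = star x + star y"
    and star_scaleC: "star (scaleC c x) = scaleC (cnj c) (star x)"
    and star_star: "star (star x) = x"
    and star_mult: "star (x * y) = star y * star x"

definition is_seminorm :: "(complex \<Rightarrow> 'a::ab_group_add \<Rightarrow> 'a) \<Rightarrow> ('a \<Rightarrow> real) \<Rightarrow> bool" where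
  "is_seminorm scaleC p \<longleftrightarrow>
     (\<forall>x. 0 \<le> p x) \<and> (\<forall>x y. p (x + y) \<le> p x + p y) \<and> (\<forall>c x. p (scaleC c x) = cmod c * p x)"

text \<open>Submultiplicativity of \<open>p\<close> is not part of the definition.\<close>

definition C_star_seminorm ::
    "(complex \<Rightarrow> 'a::{comm_ring, comm_monoid_mult} \<Rightarrow> 'a) \<Rightarrow> ('a \<Rightarrow> 'a) \<Rightarrow> ('a \<Rightarrow> real) \<Rightarrow> bool" where
  "C_star_seminorm scaleC star p \<longleftrightarrow> is_seminorm scaleC p \<and> (\<forall>x. p (x * star x) = (p x)\<^sup>2)"

text \<open>
  The open \<open>p\<close>-balls around all points form a subbase. \<^const>\<open>UNIV\<close> is added so
  that the underlying set is the whole type when the family is empty; that family gives the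
  indiscrete topology.
\<close>

definition seminorm_topology :: "('a::ab_group_add \<Rightarrow> real) set \<Rightarrow> 'a topology" where
  "seminorm_topology P =
     topology_generated_by (insert UNIV {{x. p (x - a) < r} | p a r. p \<in> P \<and> 0 < r})"

locale LC_star_algebra =
  involutive_algebra scaleC star
  for scaleC :: "complex \<Rightarrow> 'a::{comm_ring, comm_monoid_mult} \<Rightarrow> 'a"
    and star :: "'a \<Rightarrow> 'a" +
  fixes T :: "'a topology"
  assumes topology_from_seminorms:
    "\<exists>P. (\<forall>q\<in>P. C_star_seminorm scaleC star q) \<and> T = seminorm_topology P"

definition hermitian_characters ::
    "(complex \<Rightarrow> 'a::{comm_ring, comm_monoid_mult} \<Rightarrow> 'a) \<Rightarrow> ('a \<Rightarrow> 'a) \<Rightarrow> ('a \<Rightarrow> complex) set" where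
  "hermitian_characters scaleC star =
     {\<phi>. Vector_Spaces.linear scaleC (*) \<phi> \<and> (\<forall>x y. \<phi> (x * y) = \<phi> x * \<phi> y) \<and> \<phi> 1 = 1 \<and>
         (\<forall>x. \<phi> (star x) = cnj (\<phi> x))}"

definition character_space ::
    "(complex \<Rightarrow> 'a::{comm_ring, comm_monoid_mult} \<Rightarrow> 'a) \<Rightarrow> ('a \<Rightarrow> 'a) \<Rightarrow> ('a \<Rightarrow> complex) topology" where
  "character_space scaleC star =
     subtopology (product_topology (\<lambda>_. euclidean) UNIV) (hermitian_characters scaleC star)"

definition continuous_characters ::
    "(complex \<Rightarrow> 'a::{comm_ring, comm_monoid_mult} \<Rightarrow> 'a) \<Rightarrow> ('a \<Rightarrow> 'a) \<Rightarrow> 'a topology \<Rightarrow>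
     ('a \<Rightarrow> complex) set" where
  "continuous_characters scaleC star T =
     {\<phi> \<in> hermitian_characters scaleC star. continuous_map T euclidean \<phi>}"

definition lower_semicontinuous_map :: "'a topology \<Rightarrow> ('a \<Rightarrow> real) \<Rightarrow> bool" where
  "lower_semicontinuous_map T f \<longleftrightarrow> (\<forall>t. openin T {x \<in> topspace T. t < f x})"

end

theory Submission
  imports Defs
begin

text \<open>
  Write \<open>X\<^sub>q\<close> for the hermitian characters bounded by \<open>q\<close>; these are the \<open>q\<close>-continuous ones. The key
  fact is \<open>q x = max {\<bar>\<phi> x\<bar> | \<phi> \<in> X\<^sub>q}\<close> for every \<open>C\<^sup>*\<close>-seminorm \<open>q\<close>. To avoid completions and spectral
  theory, take by Zorn's lemma a minimal \<open>C\<^sup>*\<close>-seminorm below \<open>q\<close> with a prescribed value at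
  \<open>h = x x\<^sup>*\<close>. Minimality makes it multiplicative, because \<open>x \<mapsto> lim q (a\<^sup>n x)\<close> is again a
  \<open>C\<^sup>*\<close>-seminorm when \<open>a\<close> is self-adjoint with \<open>q a = 1\<close>; an Ostrowski-type Gelfand--Mazur
  argument then shows that it is \<open>\<bar>\<phi>\<bar>\<close> for a character \<open>\<phi>\<close>.

  If \<open>X\<^sub>p\<close> is the closure of \<open>S = X\<^sub>p \<inter> X\<^sub>c\<close>, then \<open>p\<close> is a supremum of the continuous functions \<open>\<bar>\<phi> x\<bar>\<close>,
  \<open>\<phi> \<in> S\<close>. Conversely let \<open>p\<close> be lower semicontinuous and \<open>\<bar>\<phi> x\<bar> \<le> c < p x\<close> on \<open>S\<close>. Some
  neighbourhood of \<open>h\<close>, given by finitely many defining seminorms \<open>q \<in> F\<close>, avoids \<open>{p \<le> t}\<close> for a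
  \<open>t > c\<^sup>2\<close>. The function equal to \<open>\<phi> h\<close> on each \<open>X\<^sub>q\<close> and to \<open>min (\<phi> h) (c\<^sup>2)\<close> on the rest of \<open>X\<^sub>p\<close> is
  continuous, so by Stone--Weierstrass it is approximated by an element \<open>a\<close> of the algebra; this \<open>a\<close>
  is close to \<open>h\<close> for all \<open>q \<in> F\<close> while \<open>p a \<le> t\<close>, a contradiction. Hence \<open>p\<close> is the supremum over
  \<open>S\<close>, and a character dominated by that supremum lies in the closure of \<open>S\<close>.
\<close>


section \<open>Separation axioms for function spaces under pointwise convergence\<close>

lemma open_vimage_apply: "open W \<Longrightarrow> open ((\<lambda>h. h i) -` W)"
  by (intro open_vimage continuous_on_product_coordinates)

text \<open>Declared from \<open>t0_space\<close> upwards, since each class must first supersede the more special arity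
  that \<open>fun\<close> has through \<^class>\<open>metric_space\<close>.\<close>

instance "fun" :: (type, t0_space) t0_space
proof
  fix f g :: "'a \<Rightarrow> 'b"
  assume "f \<noteq> g"
  then obtain i where "f i \<noteq> g i" by auto
  then obtain U where "open U" "f i \<in> U \<longleftrightarrow> g i \<notin> U"
    by (metis separation_t0)
  then show "\<exists>U. open U \<and> \<not> (f \<in> U \<longleftrightarrow> g \<in> U)"
    by (intro exI[of _ "(\<lambda>h. h i) -` U"]) (auto intro: open_vimage_apply)
qed

instance "fun" :: (type, t1_space) t1_space
proof
  fix f g :: "'a \<Rightarrow> 'b"
  assume "f \<noteq> g"
  then obtain i where "f i \<noteq> g i" by auto
  then obtain U where "open U" "f i \<in> U" "g i \<notin> U"
    by (metis t1_space)
  then show "\<exists>U. open U \<and> f \<in> U \<and> g \<notin> U"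
    by (intro exI[of _ "(\<lambda>h. h i) -` U"]) (auto intro: open_vimage_apply)
qed

instance "fun" :: (type, t2_space) t2_space
proof
  fix f g :: "'a \<Rightarrow> 'b"
  assume "f \<noteq> g"
  then obtain i where "f i \<noteq> g i" by auto
  then obtain U V where "open U" "open V" "f i \<in> U" "g i \<in> V" "U \<inter> V = {}"
    by (meson hausdorff)
  then show "\<exists>U V. open U \<and> open V \<and> f \<in> U \<and> g \<in> V \<and> U \<inter> V = {}"
    by (intro exI[of _ "(\<lambda>h. h i) -` U"] exI[of _ "(\<lambda>h. h i) -` V"])
      (auto intro: open_vimage_apply)
qed

text \<open>If u > v > 0, the powers of u / v outgrow any constant \<open>C\<close>. The exponents
  are powers of two because squaring is what the C*-identity controls.\<close>

lemma le_of_power_le: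
  fixes u v C :: real
  assumes "0 \<le> v" and "\<And>n. u ^ (2 ^ n) \<le> C * v ^ (2 ^ n)"
  shows "u \<le> v"
proof (rule ccontr)
  assume "\<not> u \<le> v"
  then have less: "v < u" by simp
  \<comment> \<open>For v = 0 the instance n = 0 would give u \<le> 0.\<close>
  have "v \<noteq> 0" using assms(2)[of 0] less by auto
  then have v: "v > 0" using assms(1) by simp
  then have gt: "u / v > 1" using less by simp
  then obtain m where "C < (u / v) ^ m" using real_arch_pow by blast
  also have "\<dots> \<le> (u / v) ^ (2 ^ m)"
    using gt by (intro power_increasing) (auto intro: less_imp_le)
  finally show False
    using assms(2)[of m] v by (simp add: power_divide field_simps)
qed

section \<open>Elementary properties and submultiplicativity of C*-seminorms\<close>

context involutive_algebra
begin

lemma scaleC_mult_right: "x * scaleC c y = scaleC c (x * y)"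
  by (metis mult.commute scaleC_mult_left)

lemma star_zero: "star 0 = 0"
  by (metis add_cancel_right_right star_add)

lemma star_minus: "star (- x) = - star x"
  by (metis add.right_inverse add_eq_0_iff star_add star_zero)

lemma star_diff: "star (x - y) = star x - star y"
  by (metis diff_conv_add_uminus star_add star_minus)

lemma star_one: "star 1 = 1"
  by (metis mult.right_neutral mult_1 star_mult star_star)

lemma star_power: "star (x ^ n) = star x ^ n"
  by (induction n) (simp_all add: star_one star_mult mult.commute)

lemma star_mult_star: "star (x * star x) = x * star x"
  by (simp add: star_mult star_star)

context
  fixes q :: "'a \<Rightarrow> real"
  assumes q: "C_star_seminorm scaleC star q"
begin

lemma seminorm_nonneg: "0 \<le> q x"
  and seminorm_add_le: "q (x + y) \<le> q x + q y"
  and seminorm_scale: "q (scaleC c x) = cmod c * q x"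
  and seminorm_mult_star: "q (x * star x) = (q x)\<^sup>2"
  using q by (auto simp: C_star_seminorm_def is_seminorm_def)

lemma seminorm_zero: "q 0 = 0"
  using seminorm_scale[of 0 0] by simp

lemma seminorm_minus: "q (- x) = q x"
  using seminorm_scale[of "-1" x] by simp

lemma seminorm_diff_le: "q (x - y) \<le> q x + q y"
  using seminorm_add_le[of x "- y"] by (simp add: seminorm_minus)

lemma seminorm_le_add_diff: "q x \<le> q y + q (x - y)"
  using seminorm_add_le[of y "x - y"] by simp

lemma seminorm_star: "q (star x) = q x"
  using seminorm_mult_star[of x] seminorm_mult_star[of "star x"] seminorm_nonneg
  by (metis mult.commute power2_eq_iff_nonneg star_star)

lemma self_adjoint_square: "star h = h \<Longrightarrow> q (h * h) = (q h)\<^sup>2"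
  using seminorm_mult_star[of h] by simp

lemma self_adjoint_power2:
  assumes "star h = h" shows "q (h ^ (2 ^ n)) = q h ^ (2 ^ n)"
proof (induction n)
  case (Suc n)
  have "q (h ^ (2 ^ Suc n)) = q (h ^ (2 ^ n) * h ^ (2 ^ n))"
    by (simp add: mult_2 power_add)
  also have "\<dots> = (q (h ^ (2 ^ n)))\<^sup>2"
    by (rule self_adjoint_square) (simp add: star_power assms)
  also have "\<dots> = q h ^ (2 ^ Suc n)"
    using Suc by (simp add: power2_eq_square mult_2 power_add)
  finally show ?case .
qed simp

text \<open>Polarisation writes the product as a difference of squares of self-adjoint elements,
  where the C*-identity applies. The strict bounds make \<open>a\<close> and \<open>b\<close>
  positive, so both factors can be rescaled into the unit ball.\<close>

lemma self_adjoint_mult_le_2: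
  assumes h: "star h = h" and k: "star k = k" and "q h < a" "q k < b"
  shows "q (h * k) \<le> 2 * (a * b)"
proof -
  have a: "a > 0" and b: "b > 0" using assms seminorm_nonneg[of h] seminorm_nonneg[of k] by linarith+
  define h' k' where "h' = scaleC (1 / a) h" and "k' = scaleC (1 / b) k"
  have sa: "star (h' + k') = h' + k'" "star (h' - k') = h' - k'"
    by (simp_all add: h'_def k'_def star_add star_diff star_scaleC h k)
  have "q h' \<le> 1" "q k' \<le> 1"
    using assms a b by (simp_all add: h'_def k'_def seminorm_scale norm_divide)
  then have le2: "q (h' + k') \<le> 2" "q (h' - k') \<le> 2"
    using seminorm_add_le[of h' k'] seminorm_diff_le[of h' k'] by linarith+
  have "scaleC 4 (h' * k') = scaleC (1 + 1 + 1 + 1) (h' * k')"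
    by simp
  also have "\<dots> = (h' + k') * (h' + k') - (h' - k') * (h' - k')"
    by (simp only: scale_left_distrib scale_one) (simp add: algebra_simps)
  finally have "4 * q (h' * k') = q ((h' + k') * (h' + k') - (h' - k') * (h' - k'))"
    using seminorm_scale[of 4 "h' * k'"] by simp
  also have "\<dots> \<le> (q (h' + k'))\<^sup>2 + (q (h' - k'))\<^sup>2"
    using seminorm_diff_le self_adjoint_square sa by metis
  also have "\<dots> \<le> 2\<^sup>2 + 2\<^sup>2"
    using le2 by (intro add_mono power_mono seminorm_nonneg)
  finally have "q (h' * k') \<le> 2" by simp
  moreover have "h' * k' = scaleC (1 / (a * b)) (h * k)"
    by (simp add: h'_def k'_def scaleC_mult_left scaleC_mult_right)
  ultimately show ?thesis
    using a b by (simp add: seminorm_scale norm_divide norm_mult field_simps)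
qed

text \<open>Raising to the powers \<open>2 ^ n\<close> removes the factor \<open>2\<close>.\<close>

lemma self_adjoint_mult_le:
  assumes h: "star h = h" and k: "star k = k"
  shows "q (h * k) \<le> q h * q k"
proof -
  \<comment> \<open>The summand \<open>e\<close> supplies the strict bounds that
    \<open>self_adjoint_mult_le_2\<close> asks for, and tends to 0 afterwards.\<close>
  have le: "q (h * k) \<le> (q h + e) * (q k + e)" if e: "e > 0" for e
  proof (rule le_of_power_le[where C = 2])
    fix n :: nat
    have "q (h * k) ^ (2 ^ n) = q (h ^ (2 ^ n) * k ^ (2 ^ n))"
      using self_adjoint_power2[of "h * k" n] h k
      by (simp add: star_mult mult.commute power_mult_distrib)
    also have "\<dots> \<le> 2 * ((q h + e) ^ (2 ^ n) * (q k + e) ^ (2 ^ n))"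
      using e h k seminorm_nonneg
      by (intro self_adjoint_mult_le_2)
        (auto simp: star_power self_adjoint_power2 intro!: power_strict_mono)
    finally show "q (h * k) ^ (2 ^ n) \<le> 2 * ((q h + e) * (q k + e)) ^ (2 ^ n)"
      by (simp add: power_mult_distrib)
  qed (use seminorm_nonneg e in \<open>simp add: add_nonneg_nonneg less_imp_le\<close>)
  have "((\<lambda>e. (q h + e) * (q k + e)) \<longlongrightarrow> (q h + 0) * (q k + 0)) (at_right 0)"
    by (intro tendsto_intros)
  then have "q (h * k) \<le> (q h + 0) * (q k + 0)"
    by (rule tendsto_lowerbound) (auto simp: eventually_at_filter le)
  then show ?thesis by simp
qed

text \<open>By commutativity, the square of the left side is the value at a product of the
  self-adjoint elements \<open>x * star x\<close> and \<open>y * star y\<close>.\<close>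

lemma seminorm_mult_le: "q (x * y) \<le> q x * q y"
proof -
  have "(q (x * y))\<^sup>2 = q ((x * star x) * (y * star y))"
    using seminorm_mult_star[of "x * y"] by (simp add: star_mult mult_ac)
  also have "\<dots> \<le> q (x * star x) * q (y * star y)"
    by (intro self_adjoint_mult_le star_mult_star)
  also have "\<dots> = (q x * q y)\<^sup>2"
    by (simp add: seminorm_mult_star power_mult_distrib)
  finally show ?thesis
    by (rule power2_le_imp_le) (simp add: seminorm_nonneg)
qed

lemma seminorm_one_cases: "q 1 = 0 \<or> q 1 = 1"
  using seminorm_mult_star[of 1] by (simp add: star_one power2_eq_square)

lemma seminorm_power_le: "q (x ^ n) \<le> q x ^ n"
proof (induction n)
  case (Suc n)
  have "q (x ^ Suc n) \<le> q x * q (x ^ n)" using seminorm_mult_le by simp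
  also have "\<dots> \<le> q x * q x ^ n" using Suc seminorm_nonneg by (intro mult_left_mono)
  finally show ?case by simp
qed (use seminorm_one_cases in auto)

lemma seminorm_one: "0 < q x \<Longrightarrow> q 1 = 1"
  using seminorm_one_cases seminorm_mult_le[of 1 x] by auto

end

section \<open>Localising a C*-seminorm at a self-adjoint element\<close>

text \<open>If \<open>q\<close> is the supremum of \<open>\<bar>\<phi>\<bar>\<close> over a set of characters and \<open>q a = 1\<close>, then
  \<open>localise q a\<close> is the supremum over those characters with \<open>\<bar>\<phi> a\<bar> = 1\<close>.\<close>

definition localise :: "('a \<Rightarrow> real) \<Rightarrow> 'a \<Rightarrow> 'a \<Rightarrow> real" where
  "localise q a x = lim (\<lambda>n. q (a ^ n * x))"

context
  fixes q :: "'a \<Rightarrow> real" and a :: 'a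
  assumes q: "C_star_seminorm scaleC star q" and a: "star a = a" "q a = 1"
begin

lemma localise_decseq: "decseq (\<lambda>n. q (a ^ n * x))"
proof (rule decseq_SucI)
  fix n
  show "q (a ^ Suc n * x) \<le> q (a ^ n * x)"
    using seminorm_mult_le[OF q, of a "a ^ n * x"] a by (simp add: mult.assoc)
qed

lemma localise_tendsto: "(\<lambda>n. q (a ^ n * x)) \<longlonglongrightarrow> localise q a x"
proof -
  have "Bseq (\<lambda>n. q (a ^ n * x))"
    using decseqD[OF localise_decseq, of 0 _ x] seminorm_nonneg[OF q] by (intro BseqI'[of _ "q x"]) auto
  then have "convergent (\<lambda>n. q (a ^ n * x))"
    using localise_decseq by (intro Bseq_monoseq_convergent decseq_imp_monoseq)
  then show ?thesis
    by (simp add: localise_def convergent_LIMSEQ_iff)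
qed

lemma localise_le: "localise q a x \<le> q x"
  using decseq_ge[OF localise_decseq localise_tendsto, of x 0] by simp

lemma localise_mult: "localise q a (a * x) = localise q a x"
  using LIMSEQ_Suc[OF localise_tendsto[of x]] localise_tendsto[of "a * x"]
  by (intro LIMSEQ_unique) (simp_all add: mult_ac)

lemma localise_one: "localise q a 1 = 1"
proof -
  \<comment> \<open>Along the exponents \<open>2 ^ n\<close> the sequence is constantly 1.\<close>
  have "(\<lambda>n. q (a ^ (2 ^ n) * 1)) \<longlonglongrightarrow> localise q a 1"
    by (rule LIMSEQ_subseq_LIMSEQ[OF localise_tendsto, unfolded o_def])
      (simp add: strict_mono_def)
  then show ?thesis
    by (simp add: self_adjoint_power2[OF q] a LIMSEQ_const_iff)
qed

lemma localise_C_star_seminorm: "C_star_seminorm scaleC star (localise q a)"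
  unfolding C_star_seminorm_def is_seminorm_def
proof (intro conjI allI)
  fix x y :: 'a and c :: complex
  show "0 \<le> localise q a x"
    using localise_tendsto by (rule LIMSEQ_le_const) (auto intro: seminorm_nonneg[OF q])
  have "(\<lambda>n. q (a ^ n * x) + q (a ^ n * y)) \<longlonglongrightarrow> localise q a x + localise q a y"
    by (intro tendsto_add localise_tendsto)
  with localise_tendsto show "localise q a (x + y) \<le> localise q a x + localise q a y"
    by (rule LIMSEQ_le) (auto simp: distrib_left intro: seminorm_add_le[OF q])
  have "(\<lambda>n. cmod c * q (a ^ n * x)) \<longlonglongrightarrow> cmod c * localise q a x"
    by (intro tendsto_mult_left localise_tendsto)
  then have "(\<lambda>n. q (a ^ n * scaleC c x)) \<longlonglongrightarrow> cmod c * localise q a x"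
    by (simp add: scaleC_mult_right seminorm_scale[OF q])
  with localise_tendsto show "localise q a (scaleC c x) = cmod c * localise q a x"
    by (rule LIMSEQ_unique)
  \<comment> \<open>Even exponents split equally between \<open>x\<close> and \<open>star x\<close>,
    so the C*-identity applies to \<open>a ^ n * x\<close>.\<close>
  have "(\<lambda>n. q (a ^ (2 * n) * (x * star x))) \<longlonglongrightarrow> localise q a (x * star x)"
    by (rule LIMSEQ_subseq_LIMSEQ[OF localise_tendsto, unfolded o_def])
      (simp add: strict_mono_def)
  moreover have "q (a ^ (2 * n) * (x * star x)) = (q (a ^ n * x))\<^sup>2" for n
    using seminorm_mult_star[OF q, of "a ^ n * x"]
    by (simp add: star_mult star_power a power_add mult_ac mult_2_right)
  ultimately have "(\<lambda>n. (q (a ^ n * x))\<^sup>2) \<longlonglongrightarrow> localise q a (x * star x)"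
    by simp
  moreover have "(\<lambda>n. (q (a ^ n * x))\<^sup>2) \<longlonglongrightarrow> (localise q a x)\<^sup>2"
    by (intro tendsto_power localise_tendsto)
  ultimately show "localise q a (x * star x) = (localise q a x)\<^sup>2"
    by (rule LIMSEQ_unique)
qed

end

section \<open>Minimal C*-seminorms\<close>

text \<open>For the triangle inequality, members of the chain that are nearly minimal at
  \<open>x\<close> and at \<open>y\<close> are replaced by the smaller of the two.\<close>

lemma chain_INF_C_star_seminorm:
  assumes C: "C \<noteq> {}" "\<And>q. q \<in> C \<Longrightarrow> C_star_seminorm scaleC star q"
    and chain: "\<And>q r. q \<in> C \<Longrightarrow> r \<in> C \<Longrightarrow> q \<le> r \<or> r \<le> q"
  shows "C_star_seminorm scaleC star (\<lambda>x. INF q\<in>C. q x)"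
  unfolding C_star_seminorm_def is_seminorm_def
proof (intro conjI allI)
  define u where "u x = (INF q\<in>C. q x)" for x
  have le: "u x \<le> q x" if "q \<in> C" for q x
    unfolding u_def using that seminorm_nonneg[OF C(2)]
    by (intro cINF_lower bdd_belowI[where m = 0]) auto
  have ge: "m \<le> u x" if "\<And>q. q \<in> C \<Longrightarrow> m \<le> q x" for m x
    unfolding u_def using that C(1) by (intro cINF_greatest) auto
  have lt: "\<exists>q\<in>C. q x < u x + e" if "e > 0" for x e
    using ge[of "u x + e" x] that by force
  fix x y :: 'a and c :: complex
  have u0: "0 \<le> u x" for x
    by (intro ge seminorm_nonneg C(2))
  then show "0 \<le> (INF q\<in>C. q x)" by (simp add: u_def)
  show "(INF q\<in>C. q (x + y)) \<le> (INF q\<in>C. q x) + (INF q\<in>C. q y)"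
    unfolding u_def[symmetric]
  proof (rule field_le_epsilon)
    fix e :: real assume "e > 0"
    then obtain q r where qr: "q \<in> C" "r \<in> C" "q x < u x + e / 2" "r y < u y + e / 2"
      using lt[of "e / 2"] by (meson half_gt_zero)
    obtain s where s: "s \<in> C" "s \<le> q" "s \<le> r"
      using chain[OF qr(1,2)] qr by blast
    have "u (x + y) \<le> s x + s y"
      using le[OF s(1)] seminorm_add_le[OF C(2)[OF s(1)]] order_trans by blast
    also have "\<dots> \<le> u x + u y + e"
      using s(2,3) qr(3,4) by (smt (verit) field_sum_of_halves le_funD)
    finally show "u (x + y) \<le> u x + u y + e" .
  qed
  have scale_ge: "cmod c * u x \<le> u (scaleC c x)" for c x
    by (rule ge) (simp add: seminorm_scale[OF C(2)] mult_left_mono le)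
  show "(INF q\<in>C. q (scaleC c x)) = cmod c * (INF q\<in>C. q x)"
    unfolding u_def[symmetric]
  proof (cases "c = 0")
    case True
    obtain q where "q \<in> C" using C(1) by blast
    then have "u 0 \<le> 0" using le[of q 0] seminorm_zero[OF C(2)[of q]] by simp
    then show "u (scaleC c x) = cmod c * u x" using True u0[of 0] by simp
  next
    \<comment> \<open>The reverse inequality is \<open>scale_ge\<close> for \<open>inverse c\<close>
      at the point \<open>scaleC c x\<close>.\<close>
    case False
    then show "u (scaleC c x) = cmod c * u x"
      using scale_ge[of c x] scale_ge[of "inverse c" "scaleC c x"]
      by (simp add: norm_inverse norm_divide field_simps)
  qed
  show "(INF q\<in>C. q (x * star x)) = (INF q\<in>C. q x)\<^sup>2"
    unfolding u_def[symmetric]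
  proof (rule antisym)
    have "sqrt (u (x * star x)) \<le> q x" if "q \<in> C" for q
      using le[OF that, of "x * star x"] seminorm_mult_star[OF C(2)[OF that]] seminorm_nonneg[OF C(2)[OF that]]
      by (intro real_le_lsqrt) auto
    then have "sqrt (u (x * star x)) \<le> u x" by (rule ge)
    then show "u (x * star x) \<le> (u x)\<^sup>2" by (simp add: sqrt_le_D)
    show "(u x)\<^sup>2 \<le> u (x * star x)"
      by (rule ge) (simp add: seminorm_mult_star[OF C(2)] power_mono le u0)
  qed
qed

lemma minimal_C_star_seminorm:
  assumes p: "C_star_seminorm scaleC star p"
  obtains m where "C_star_seminorm scaleC star m" "m \<le> p" "m h = p h"
    "\<And>q. C_star_seminorm scaleC star q \<Longrightarrow> q \<le> m \<Longrightarrow> q h = p h \<Longrightarrow> q = m"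
proof -
  define A where "A = {q. C_star_seminorm scaleC star q \<and> q \<le> p \<and> q h = p h}"
  have "\<exists>m\<in>A. \<forall>q\<in>A. m \<ge> q \<longrightarrow> q = m"
  proof (rule predicate_Zorn)
    show "partial_order_on A (relation_of (\<ge>) A)"
      by (rule partial_order_on_relation_ofI) auto
    fix C assume "C \<in> Chains (relation_of (\<ge>) A)"
    then have CA: "C \<subseteq> A"
      by (auto simp: Chains_def relation_of_def)
    have chain: "q \<le> r \<or> r \<le> q" if "q \<in> C" "r \<in> C" for q r
      using that \<open>C \<in> _\<close> by (auto simp: Chains_def relation_of_def)
    show "\<exists>u\<in>A. \<forall>q\<in>C. q \<ge> u"
    proof (cases "C = {}")
      \<comment> \<open>The empty chain is bounded below by \<open>p\<close> itself.\<close>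
      case True
      then show ?thesis using p by (auto simp: A_def)
    next
      case False
      define u where "u x = (INF q\<in>C. q x)" for x
      have cs: "C_star_seminorm scaleC star q" if "q \<in> C" for q
        using that CA by (auto simp: A_def)
      have u: "C_star_seminorm scaleC star u"
        unfolding u_def by (rule chain_INF_C_star_seminorm) (use False cs chain in auto)
      have le: "u \<le> q" if "q \<in> C" for q
        unfolding le_fun_def u_def using that seminorm_nonneg[OF cs]
        by (intro allI cINF_lower bdd_belowI[where m = 0]) auto
      have "u h = (INF q\<in>C. p h)"
        unfolding u_def using CA by (intro INF_cong) (auto simp: A_def)
      then have "u h = p h" using False by simp
      moreover have "u \<le> p"
        using False le CA order_trans unfolding A_def by blast
      ultimately show ?thesis using u le by (auto simp: A_def)
    qed
  qed
  then show thesis using that by (auto simp: A_def)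
qed

text \<open>Localising at \<open>a\<close> leaves \<open>m\<close> unchanged as soon as it keeps the
  value at \<open>h\<close>, and then \<open>m\<close> ignores the factor \<open>a\<close>. This is
  shown first for the normalised \<open>h\<close>, then for every self-adjoint \<open>a\<close> with
  \<open>m a = 1\<close>; scaling and the C*-identity give the rest.\<close>

lemma minimal_imp_multiplicative:
  assumes m: "C_star_seminorm scaleC star m" and h: "star h = h" "m h > 0"
    and minimal: "\<And>q. C_star_seminorm scaleC star q \<Longrightarrow> q \<le> m \<Longrightarrow> q h = m h \<Longrightarrow> q = m"
  shows "m (x * y) = m x * m y"
proof -
  have loc_eq: "localise m a = m" if "star a = a" "m a = 1" "localise m a h = m h" for a
    using minimal[OF localise_C_star_seminorm[OF m that(1,2)]] localise_le[OF m that(1,2)] that(3)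
    by (auto simp: le_fun_def)
  define k where "k = scaleC (1 / m h) h"
  have k: "star k = k" "m k = 1"
    using h by (simp_all add: k_def star_scaleC seminorm_scale[OF m] norm_divide)
  have hk: "h = scaleC (m h) k" using h by (simp add: k_def)
  \<comment> \<open>As \<open>h\<close> is a multiple of \<open>k\<close>, and localising at
    \<open>k\<close> absorbs that factor, the value at \<open>h\<close> is \<open>m h\<close> times
    the value at 1.\<close>
  have "localise m k h = m h * localise m k (k * 1)"
    by (subst (1) hk) (use h in \<open>simp add: seminorm_scale[OF localise_C_star_seminorm[OF m k]]\<close>)
  then have "localise m k h = m h"
    by (simp only: localise_mult[OF m k] localise_one[OF m k])
  then have "localise m k = m" by (rule loc_eq[OF k])
  then have mk: "m (k * x) = m x" for x
    using localise_mult[OF m k, of x] by simp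
  have unit: "m (a * x) = m x" if a: "star a = a" "m a = 1" for a x
  proof -
    \<comment> \<open>By \<open>mk\<close> the factor \<open>k\<close> hidden in \<open>h\<close>
      disappears, which again reduces the value at \<open>h\<close> to the value at 1.\<close>
    have "m (a ^ n * h) = m h * m (a ^ n * 1)" for n
      using mk[of "a ^ n"] h
      by (subst hk) (simp add: scaleC_mult_right seminorm_scale[OF m] mult.commute)
    then have "(\<lambda>n. m (a ^ n * h)) \<longlonglongrightarrow> m h * localise m a 1"
      using tendsto_mult_left[OF localise_tendsto[OF m a, of 1], of "m h"] by simp
    then have "localise m a h = m h"
      using LIMSEQ_unique[OF localise_tendsto[OF m a]] by (simp add: localise_one[OF m a])
    then have "localise m a = m" by (rule loc_eq[OF a])
    then show ?thesis using localise_mult[OF m a, of x] by simp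
  qed
  have sa: "m (a * x) = m a * m x" if a: "star a = a" for a x
  proof (cases "m a = 0")
    case True
    then show ?thesis using seminorm_mult_le[OF m, of a x] seminorm_nonneg[OF m, of "a * x"] by simp
  next
    case False
    then have pos: "m a > 0" using seminorm_nonneg[OF m, of a] by simp
    define b where "b = scaleC (1 / m a) a"
    have "star b = b" "m b = 1" "a = scaleC (m a) b"
      using a pos by (simp_all add: b_def star_scaleC seminorm_scale[OF m] norm_divide)
    then show ?thesis
      using unit[of b x] pos by (metis abs_of_pos norm_of_real seminorm_scale[OF m] scaleC_mult_left)
  qed
  have "(m (x * y))\<^sup>2 = m ((x * star x) * (y * star y))"
    using seminorm_mult_star[OF m, of "x * y"] by (simp add: star_mult mult_ac)
  also have "\<dots> = (m x * m y)\<^sup>2"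
    by (simp add: sa star_mult_star seminorm_mult_star[OF m] power_mult_distrib)
  finally show ?thesis
    using seminorm_nonneg[OF m] by (simp add: power2_eq_iff_nonneg)
qed

section \<open>A Gelfand-Mazur argument for multiplicative seminorms\<close>

lemma linear_iff_hom:
  "Vector_Spaces.linear scaleC (*) f \<longleftrightarrow>
    (\<forall>x y. f (x + y) = f x + f y) \<and> (\<forall>c x. f (scaleC c x) = c * f x)"
proof -
  have "vector_space ((*) :: complex \<Rightarrow> complex \<Rightarrow> complex)"
    by unfold_locales (simp_all add: algebra_simps)
  then show ?thesis
    by (simp add: Vector_Spaces.linear_iff vector_space_axioms)
qed

context
  fixes m :: "'a \<Rightarrow> real"
  assumes m: "C_star_seminorm scaleC star m" and one: "m 1 = 1"
    and mult: "\<And>x y. m (x * y) = m x * m y"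
begin

lemma multiplicative_power: "m (x ^ n) = m x ^ n"
  by (induction n) (simp_all add: one mult)

lemma seminorm_scalar: "m (scaleC c 1) = cmod c"
  by (simp add: seminorm_scale[OF m] one)

text \<open>With s a square root of l, x^(2N) - l factors as (x^N - s)(x^N + s). The induction
  generalises over \<open>l\<close> in order to bound both factors.\<close>

lemma dist_scalar_ge:
  assumes min: "\<And>l. r \<le> m (x - scaleC l 1)" and r: "0 \<le> r"
  shows "r ^ (2 ^ n) \<le> m (x ^ (2 ^ n) - scaleC l 1)"
proof (induction n arbitrary: l)
  case 0
  then show ?case using min by simp
next
  case (Suc n)
  define s where "s = csqrt l"
  have l: "l = s * s" using power2_csqrt[of l] by (simp add: s_def power2_eq_square)
  let ?y = "x ^ (2 ^ n)"
  have "x ^ (2 ^ Suc n) - scaleC l 1 = (?y - scaleC s 1) * (?y - scaleC (- s) 1)"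
    by (simp add: l algebra_simps scaleC_mult_left scaleC_mult_right mult_2 power_add)
  then have "m (x ^ (2 ^ Suc n) - scaleC l 1) = m (?y - scaleC s 1) * m (?y - scaleC (- s) 1)"
    by (simp only: mult)
  moreover have "r ^ (2 ^ n) * r ^ (2 ^ n) \<le> \<dots>"
    by (intro mult_mono seminorm_nonneg[OF m] Suc zero_le_power r)
  ultimately show ?case by (simp add: mult_2 power_add)
qed

text \<open>For N = \<open>2 ^ n\<close>, one factor of x^N - l^N is x - l and the other N - 1 have
  size at least \<open>r\<close>. Both sides carry an extra factor \<open>r\<close> to avoid the
  exponent N - 1.\<close>

lemma dist_scalar_product:
  assumes min: "\<And>l. r \<le> m (x - scaleC l 1)" and r: "0 \<le> r"
  shows "m (x - scaleC l 1) * r ^ (2 ^ n) \<le> r * m (x ^ (2 ^ n) - scaleC (l ^ (2 ^ n)) 1)"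
proof (induction n)
  case (Suc n)
  let ?y = "x ^ (2 ^ n)" and ?k = "l ^ (2 ^ n)"
  have "x ^ (2 ^ Suc n) - scaleC (l ^ (2 ^ Suc n)) 1 = (?y - scaleC ?k 1) * (?y - scaleC (- ?k) 1)"
    by (simp add: algebra_simps scaleC_mult_left scaleC_mult_right mult_2 power_add)
  then have eq: "m (x ^ (2 ^ Suc n) - scaleC (l ^ (2 ^ Suc n)) 1) =
      m (?y - scaleC ?k 1) * m (?y - scaleC (- ?k) 1)"
    by (simp only: mult)
  have "(m (x - scaleC l 1) * r ^ (2 ^ n)) * r ^ (2 ^ n) \<le>
      (r * m (?y - scaleC ?k 1)) * m (?y - scaleC (- ?k) 1)"
    by (rule mult_mono[OF Suc dist_scalar_ge[OF min r]])
      (intro mult_nonneg_nonneg seminorm_nonneg[OF m] zero_le_power r)+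
  then show ?case unfolding eq by (simp add: mult_2 power_add mult.assoc)
qed simp

text \<open>Compare \<open>x ^ N - l ^ N\<close>, a product of \<open>N\<close> factors \<open>x - \<omega> l\<close> of size at least \<open>r\<close>, with its
  upper bound \<open>r ^ N + \<bar>l\<bar> ^ N\<close> as \<open>N = 2 ^ n \<rightarrow> \<infinity>\<close>.\<close>

lemma dist_scalar_const:
  assumes min: "\<And>l. m x \<le> m (x - scaleC l 1)" and l: "cmod l < m x"
  shows "m (x - scaleC l 1) = m x"
proof (rule antisym[OF _ min])
  define r where "r = m x"
  have r: "r > 0" using l norm_ge_zero[of l] unfolding r_def by linarith
  have bound: "m (x - scaleC l 1) \<le> r * (1 + (cmod l / r) ^ (2 ^ n))" for n
  proof -
    have "m (x - scaleC l 1) * r ^ (2 ^ n) \<le> r * m (x ^ (2 ^ n) - scaleC (l ^ (2 ^ n)) 1)"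
      using dist_scalar_product[of r x l n] min r by (simp add: r_def)
    also have "\<dots> \<le> r * (r ^ (2 ^ n) + cmod l ^ (2 ^ n))"
      using seminorm_diff_le[OF m, of "x ^ (2 ^ n)" "scaleC (l ^ (2 ^ n)) 1"] r
      by (simp add: multiplicative_power seminorm_scalar norm_power r_def)
    also have "\<dots> = (r * (1 + (cmod l / r) ^ (2 ^ n))) * r ^ (2 ^ n)"
      using r by (simp add: power_divide field_simps)
    finally show ?thesis using r by simp
  qed
  have "(\<lambda>k. (cmod l / r) ^ k) \<longlonglongrightarrow> 0"
    using l r by (intro LIMSEQ_realpow_zero) (auto simp: r_def)
  then have "(\<lambda>n. (cmod l / r) ^ (2 ^ n)) \<longlonglongrightarrow> 0"
    by (rule LIMSEQ_subseq_LIMSEQ[unfolded o_def]) (simp add: strict_mono_def)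
  then have "(\<lambda>n. r * (1 + (cmod l / r) ^ (2 ^ n))) \<longlonglongrightarrow> r * (1 + 0)"
    by (intro tendsto_intros)
  then show "m (x - scaleC l 1) \<le> m x"
    using bound by (intro LIMSEQ_le_const) (auto simp: r_def)
qed

text \<open>The distance from \<open>x\<close> to the scalars attains its minimum. Were it positive,
  \<open>dist_scalar_const\<close> would make the distance constant on a disc about each minimiser,
  hence along an unbounded sequence of scalars, against its growth at infinity.\<close>

lemma exists_scalar: "\<exists>l. m (x - scaleC l 1) = 0"
proof -
  define f where "f l = m (x - scaleC l 1)" for l
  have lip: "\<bar>f k - f l\<bar> \<le> cmod (k - l)" for k l
  proof -
    have "f k \<le> f l + cmod (l - k)" for k l
      using seminorm_add_le[OF m, of "x - scaleC l 1" "scaleC (l - k) 1"]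
      by (simp add: f_def scale_left_diff_distrib seminorm_scalar flip: seminorm_scalar)
    from this[of k l] this[of l k] show ?thesis
      by (simp add: abs_le_iff norm_minus_commute)
  qed
  \<comment> \<open>Outside this disc \<open>f\<close> exceeds \<open>f 0 = m x\<close>, so the
    minimum over the disc is global.\<close>
  have "continuous_on (cball 0 (2 * m x)) f"
    unfolding continuous_on_iff dist_norm
    by (metis lip le_less_trans real_norm_def norm_minus_commute)
  then obtain l0 where l0: "\<And>l. cmod l \<le> 2 * m x \<Longrightarrow> f l0 \<le> f l"
    using continuous_attains_inf[of "cball 0 (2 * m x)" f] seminorm_nonneg[OF m, of x] by force
  have far: "cmod l - m x \<le> f l" for l
    using seminorm_le_add_diff[OF m, of "scaleC l 1" x] seminorm_minus[OF m, of "x - scaleC l 1"]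
    by (simp add: f_def seminorm_scalar)
  have min: "f l0 \<le> f l" for l
  proof (cases "cmod l \<le> 2 * m x")
    case False
    then show ?thesis using far[of l] l0[of 0] seminorm_nonneg[OF m, of x] by (simp add: f_def)
  qed (rule l0)
  have "f l0 = 0"
  proof (rule ccontr)
    assume "f l0 \<noteq> 0"
    then have r: "f l0 > 0" using seminorm_nonneg[OF m] by (simp add: f_def less_le)
    have f_shift: "f (a + b) = m (x - scaleC a 1 - scaleC b 1)" for a b
      by (simp add: f_def scale_left_distrib algebra_simps)
    have step: "f (l + k) = f l0" if "f l = f l0" "cmod k < f l0" for l k
    proof -
      have "m (x - scaleC l 1 - scaleC k 1) = m (x - scaleC l 1)"
        using that min f_shift by (intro dist_scalar_const) (metis f_def)+
      then show ?thesis using that(1) f_shift[of l k] by (simp add: f_def)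
    qed
    \<comment> \<open>Steps of half the radius stay strictly inside the disc about the current
      minimiser.\<close>
    have const: "f (l0 + of_nat n * of_real (f l0 / 2)) = f l0" for n
    proof (induction n)
      case (Suc n)
      have "l0 + of_nat (Suc n) * of_real (f l0 / 2) =
          (l0 + of_nat n * of_real (f l0 / 2)) + complex_of_real (f l0 / 2)"
        by (simp add: algebra_simps)
      moreover have "cmod (complex_of_real (f l0 / 2)) < f l0"
        unfolding norm_of_real using r by simp
      ultimately show ?case using step[OF Suc] by metis
    qed simp
    obtain n where n: "f l0 + m x + cmod l0 < of_nat n * (f l0 / 2)"
      using r reals_Archimedean3[of "f l0 / 2"] half_gt_zero by blast
    have "cmod (of_nat n * complex_of_real (f l0 / 2)) = of_nat n * (f l0 / 2)"
      unfolding norm_mult norm_of_real norm_of_nat using r by simp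
    then have "of_nat n * (f l0 / 2) \<le> cmod (l0 + of_nat n * of_real (f l0 / 2)) + cmod l0"
      using norm_triangle_ineq2[of "of_nat n * complex_of_real (f l0 / 2)" "- l0"]
      by (simp add: add.commute)
    then show False
      using far[of "l0 + of_nat n * of_real (f l0 / 2)"] const[of n] n by linarith
  qed
  then show ?thesis by (auto simp: f_def)
qed

text \<open>The scalar at zero distance from \<open>x\<close> is unique, since \<open>m\<close> is
  the modulus on scalars. Each law for \<phi> therefore holds once the expected scalar is seen to be
  at distance zero.\<close>

lemma character_of_multiplicative:
  obtains \<phi> where "\<phi> \<in> hermitian_characters scaleC star" "\<And>x. cmod (\<phi> x) = m x"
proof -
  obtain \<phi> where \<phi>: "\<And>x. m (x - scaleC (\<phi> x) 1) = 0"
    using exists_scalar by metis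
  have eq: "\<phi> x = l" if "m (x - scaleC l 1) = 0" for x l
  proof -
    have "scaleC (\<phi> x - l) 1 = (x - scaleC l 1) - (x - scaleC (\<phi> x) 1)"
      by (simp add: scale_left_diff_distrib)
    then have "cmod (\<phi> x - l) \<le> 0"
      using seminorm_diff_le[OF m, of "x - scaleC l 1" "x - scaleC (\<phi> x) 1"] that \<phi>[of x]
      by (simp flip: seminorm_scalar)
    then show ?thesis by simp
  qed
  have eq': "\<phi> x = l" if "x - scaleC l 1 = y + z" "m y = 0" "m z = 0" for x y z l
    using that seminorm_add_le[OF m, of y z] seminorm_nonneg[OF m, of "y + z"] by (intro eq) simp
  have "\<phi> (x + y) = \<phi> x + \<phi> y" for x y
    by (rule eq'[OF _ \<phi>[of x] \<phi>[of y]]) (simp add: scale_left_distrib)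
  moreover have "\<phi> (scaleC c x) = c * \<phi> x" for c x
    using \<phi>[of x] seminorm_scale[OF m, of c "x - scaleC (\<phi> x) 1"]
    by (intro eq) (simp add: scale_right_diff_distrib)
  moreover have "\<phi> (x * y) = \<phi> x * \<phi> y" for x y
  proof (rule eq')
    show "x * y - scaleC (\<phi> x * \<phi> y) 1 =
        x * (y - scaleC (\<phi> y) 1) + scaleC (\<phi> y) (x - scaleC (\<phi> x) 1)"
      by (simp add: algebra_simps scaleC_mult_right scale_right_diff_distrib)
    show "m (x * (y - scaleC (\<phi> y) 1)) = 0" "m (scaleC (\<phi> y) (x - scaleC (\<phi> x) 1)) = 0"
      by (simp_all only: mult seminorm_scale[OF m] \<phi> mult_zero_right)
  qed
  moreover have "\<phi> 1 = 1"
    by (rule eq) (simp add: seminorm_zero[OF m])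
  moreover have "\<phi> (star x) = cnj (\<phi> x)" for x
    using \<phi>[of x] seminorm_star[OF m, of "x - scaleC (\<phi> x) 1"]
    by (intro eq) (simp add: star_diff star_scaleC star_one)
  ultimately have "\<phi> \<in> hermitian_characters scaleC star"
    by (simp add: hermitian_characters_def linear_iff_hom)
  moreover have "cmod (\<phi> x) = m x" for x
    using seminorm_le_add_diff[OF m, of x "scaleC (\<phi> x) 1"] \<phi>[of x]
      seminorm_le_add_diff[OF m, of "scaleC (\<phi> x) 1" x] seminorm_minus[OF m, of "x - scaleC (\<phi> x) 1"]
    by (simp add: seminorm_scalar)
  ultimately show thesis by (rule that)
qed

end

section \<open>Characters attaining the value of a C*-seminorm\<close>

definition bounded_characters :: "('a \<Rightarrow> real) \<Rightarrow> ('a \<Rightarrow> complex) set" where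
  "bounded_characters q = {\<phi> \<in> hermitian_characters scaleC star. \<forall>x. cmod (\<phi> x) \<le> q x}"

text \<open>Minimality fixes the value at \<open>h = x * star x\<close> because localisation needs a
  self-adjoint element; the C*-identity returns the value at \<open>x\<close>.\<close>

lemma attained_by_character:
  assumes p: "C_star_seminorm scaleC star p" and "0 < p x"
  obtains \<phi> where "\<phi> \<in> bounded_characters p" "cmod (\<phi> x) = p x"
proof -
  define h where "h = x * star x"
  have h: "star h = h" "p h = (p x)\<^sup>2"
    by (simp_all add: h_def star_mult_star seminorm_mult_star[OF p])
  obtain m where m: "C_star_seminorm scaleC star m" "m \<le> p" "m h = p h"
    "\<And>q. C_star_seminorm scaleC star q \<Longrightarrow> q \<le> m \<Longrightarrow> q h = p h \<Longrightarrow> q = m"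
    using minimal_C_star_seminorm[OF p, of h] by metis
  have pos: "m h > 0" using m(3) h assms(2) by simp
  have mult: "m (x * y) = m x * m y" for x y
    by (rule minimal_imp_multiplicative[OF m(1) h(1) pos]) (use m in auto)
  obtain \<phi> where \<phi>: "\<phi> \<in> hermitian_characters scaleC star" "\<And>x. cmod (\<phi> x) = m x"
    using character_of_multiplicative[OF m(1) seminorm_one[OF m(1) pos] mult] by blast
  show thesis
  proof (rule that)
    show "\<phi> \<in> bounded_characters p"
      using \<phi> m(2) by (auto simp: bounded_characters_def le_fun_def)
    have "(m x)\<^sup>2 = (p x)\<^sup>2"
      using seminorm_mult_star[OF m(1), of x] m(3) h by (simp add: h_def)
    then show "cmod (\<phi> x) = p x"
      using \<phi>(2) seminorm_nonneg[OF p] seminorm_nonneg[OF m(1)] by (simp add: power2_eq_iff_nonneg)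
  qed
qed

section \<open>Seminorm topologies and their continuous characters\<close>

lemma openin_seminorm_topology_iff:
  assumes P: "\<forall>q\<in>P. C_star_seminorm scaleC star q"
  shows "openin (seminorm_topology P) U \<longleftrightarrow>
    (\<forall>x\<in>U. \<exists>F e. finite F \<and> F \<subseteq> P \<and> 0 < e \<and> {y. \<forall>q\<in>F. q (y - x) < e} \<subseteq> U)"
proof
  assume "openin (seminorm_topology P) U"
  then have "generate_topology_on (insert UNIV {{x. p (x - a) < r} | p a r. p \<in> P \<and> 0 < r}) U"
    by (simp add: seminorm_topology_def openin_topology_generated_by_iff)
  then show "\<forall>x\<in>U. \<exists>F e. finite F \<and> F \<subseteq> P \<and> 0 < e \<and> {y. \<forall>q\<in>F. q (y - x) < e} \<subseteq> U"
  proof induction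
    case (Int U V)
    show ?case
    proof
      fix x assume x: "x \<in> U \<inter> V"
      obtain F e where F: "finite F" "F \<subseteq> P" "0 < e" "{y. \<forall>q\<in>F. q (y - x) < e} \<subseteq> U"
        using Int x by (meson IntD1)
      obtain G d where G: "finite G" "G \<subseteq> P" "0 < d" "{y. \<forall>q\<in>G. q (y - x) < d} \<subseteq> V"
        using Int x by (meson IntD2)
      show "\<exists>F e. finite F \<and> F \<subseteq> P \<and> 0 < e \<and> {y. \<forall>q\<in>F. q (y - x) < e} \<subseteq> U \<inter> V"
        using F G by (intro exI[of _ "F \<union> G"] exI[of _ "min e d"]) auto
    qed
  next
    case (UN K)
    show ?case
    proof
      fix x assume "x \<in> \<Union>K"
      then obtain k where "k \<in> K" "x \<in> k" by blast
      then obtain F e where "finite F" "F \<subseteq> P" "0 < e" "{y. \<forall>q\<in>F. q (y - x) < e} \<subseteq> k"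
        using UN by meson
      then show "\<exists>F e. finite F \<and> F \<subseteq> P \<and> 0 < e \<and> {y. \<forall>q\<in>F. q (y - x) < e} \<subseteq> \<Union>K"
        using \<open>k \<in> K\<close> by blast
    qed
  next
    case (Basis s)
    show ?case
    proof
      fix x assume x: "x \<in> s"
      consider "s = UNIV" | q a r where "q \<in> P" "s = {x. q (x - a) < r}"
        using Basis by blast
      then show "\<exists>F e. finite F \<and> F \<subseteq> P \<and> 0 < e \<and> {y. \<forall>q\<in>F. q (y - x) < e} \<subseteq> s"
      proof cases
        case 1
        then show ?thesis by (intro exI[of _ "{}"] exI[of _ 1]) auto
      next
        case 2
        \<comment> \<open>A ball of radius \<open>r\<close> about \<open>a\<close> contains the ball
          of radius \<open>r - q (x - a)\<close> about each of its points \<open>x\<close>.\<close>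
        have "q (y - a) \<le> q (y - x) + q (x - a)" for y
          using seminorm_add_le[OF bspec[OF P 2(1)], of "y - x" "x - a"] by simp
        then have "{y. \<forall>q\<in>{q}. q (y - x) < r - q (x - a)} \<subseteq> s"
          unfolding 2(2) by (smt (verit) Collect_mono insertI1)
        then show ?thesis
          using 2 x by (intro exI[of _ "{q}"] exI[of _ "r - q (x - a)"]) auto
      qed
    qed
  qed simp
next
  assume nbhd: "\<forall>x\<in>U. \<exists>F e. finite F \<and> F \<subseteq> P \<and> 0 < e \<and> {y. \<forall>q\<in>F. q (y - x) < e} \<subseteq> U"
  have basic: "openin (seminorm_topology P) {y. q (y - x) < e}" if "q \<in> P" "0 < e" for q x e
    unfolding seminorm_topology_def using that by (intro topology_generated_by_Basis) blast
  have univ: "openin (seminorm_topology P) UNIV"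
    unfolding seminorm_topology_def by (intro topology_generated_by_Basis) blast
  show "openin (seminorm_topology P) U"
  proof (subst openin_subopen, intro ballI)
    fix x assume "x \<in> U"
    then obtain F e where F: "finite F" "F \<subseteq> P" "0 < e" "{y. \<forall>q\<in>F. q (y - x) < e} \<subseteq> U"
      using nbhd by meson
    have "openin (seminorm_topology P) (UNIV \<inter> (\<Inter>q\<in>F. {y. q (y - x) < e}))"
      using F basic univ
      by (cases "F = {}") (auto intro!: openin_Int openin_Inter)
    moreover have "q (x - x) < e" if "q \<in> F" for q
      using seminorm_zero[of q] P F that by auto
    ultimately show "\<exists>V. openin (seminorm_topology P) V \<and> x \<in> V \<and> V \<subseteq> U"
      using F by (intro exI[of _ "UNIV \<inter> (\<Inter>q\<in>F. {y. q (y - x) < e})"]) auto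
  qed
qed


lemma openin_seminorm_topologyE:
  assumes "\<forall>q\<in>P. C_star_seminorm scaleC star q" "openin (seminorm_topology P) U" "x \<in> U"
  obtains F e where "finite F" "F \<subseteq> P" "0 < e" "{y. \<forall>q\<in>F. q (y - x) < e} \<subseteq> U"
  using assms openin_seminorm_topology_iff[OF assms(1), of U] by blast

lemma topspace_seminorm_topology: "topspace (seminorm_topology P) = UNIV"
  by (simp add: seminorm_topology_def)

lemma hermitian_characterD:
  assumes "\<phi> \<in> hermitian_characters scaleC star"
  shows "\<phi> (x + y) = \<phi> x + \<phi> y" "\<phi> (x - y) = \<phi> x - \<phi> y" "\<phi> (scaleC c x) = c * \<phi> x"
    "\<phi> (x * y) = \<phi> x * \<phi> y" "\<phi> 1 = 1" "\<phi> (star x) = cnj (\<phi> x)"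
    "\<phi> (x ^ n) = \<phi> x ^ n" "\<phi> (x * star x) = of_real ((cmod (\<phi> x))\<^sup>2)"
proof -
  have *: "\<And>x y. \<phi> (x + y) = \<phi> x + \<phi> y" "\<And>c x. \<phi> (scaleC c x) = c * \<phi> x"
      "\<And>x y. \<phi> (x * y) = \<phi> x * \<phi> y" "\<phi> 1 = 1" "\<And>x. \<phi> (star x) = cnj (\<phi> x)"
    using assms by (auto simp: hermitian_characters_def linear_iff_hom)
  then show "\<phi> (x + y) = \<phi> x + \<phi> y" "\<phi> (scaleC c x) = c * \<phi> x" "\<phi> (x * y) = \<phi> x * \<phi> y"
    "\<phi> 1 = 1" "\<phi> (star x) = cnj (\<phi> x)" by blast+
  show "\<phi> (x - y) = \<phi> x - \<phi> y"
    using *(1)[of "x - y" y] by simp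
  show "\<phi> (x ^ n) = \<phi> x ^ n"
    by (induction n) (simp_all add: *)
  show "\<phi> (x * star x) = of_real ((cmod (\<phi> x))\<^sup>2)"
    by (simp only: * complex_norm_square)
qed

lemma self_adjoint_character_real:
  assumes "\<phi> \<in> hermitian_characters scaleC star" "star h = h"
  shows "\<phi> h = of_real (Re (\<phi> h))"
  using hermitian_characterD(6)[OF assms(1), of h] assms(2)
  by (metis Reals_cnj_iff of_real_Re)

lemma bounded_charactersD:
  assumes "\<phi> \<in> bounded_characters q"
  shows "\<phi> \<in> hermitian_characters scaleC star" "cmod (\<phi> x) \<le> q x"
  using assms by (auto simp: bounded_characters_def)

lemma bounded_characters_continuous:
  assumes P: "\<forall>q\<in>P. C_star_seminorm scaleC star q"
    and "q \<in> P" and \<phi>: "\<phi> \<in> bounded_characters q"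
  shows "\<phi> \<in> continuous_characters scaleC star (seminorm_topology P)"
proof -
  have "openin (seminorm_topology P) {x. \<phi> x \<in> U}" if "open U" for U
    unfolding openin_seminorm_topology_iff[OF P]
  proof
    fix x assume "x \<in> {x. \<phi> x \<in> U}"
    then obtain e where e: "e > 0" "\<And>z. dist z (\<phi> x) < e \<Longrightarrow> z \<in> U"
      using \<open>open U\<close> by (auto simp: open_dist)
    have "dist (\<phi> y) (\<phi> x) \<le> q (y - x)" for y
      using bounded_charactersD(2)[OF \<phi>, of "y - x"]
      by (simp add: hermitian_characterD[OF bounded_charactersD(1)[OF \<phi>]] dist_norm)
    then have "{y. \<forall>r\<in>{q}. r (y - x) < e} \<subseteq> {x. \<phi> x \<in> U}"
      using e(2) by (auto intro: le_less_trans)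
    then show "\<exists>F e. finite F \<and> F \<subseteq> P \<and> 0 < e \<and> {y. \<forall>r\<in>F. r (y - x) < e} \<subseteq> {x. \<phi> x \<in> U}"
      using e(1) \<open>q \<in> P\<close> by (intro exI[of _ "{q}"] exI[of _ e]) simp
  qed
  then show ?thesis
    using bounded_charactersD(1)[OF \<phi>]
    by (auto simp: continuous_characters_def continuous_map_def topspace_seminorm_topology)
qed

text \<open>Continuity at 0 maps some ball \<open>p y < e\<close> into the open unit disc. If the
  bound failed at \<open>x\<close>, a multiple \<open>z\<close> would satisfy \<phi> z = 1 and
  \<open>p z < 1\<close>; powers of \<open>z\<close> enter that ball while \<phi> stays 1 on
  them.\<close>

lemma continuous_characters_singleton:
  assumes p: "C_star_seminorm scaleC star p"
  shows "continuous_characters scaleC star (seminorm_topology {p}) = bounded_characters p"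
proof (intro equalityI subsetI)
  fix \<phi> assume "\<phi> \<in> continuous_characters scaleC star (seminorm_topology {p})"
  then have \<phi>: "\<phi> \<in> hermitian_characters scaleC star"
    and cont: "continuous_map (seminorm_topology {p}) euclidean \<phi>"
    by (auto simp: continuous_characters_def)
  have \<phi>0: "\<phi> 0 = 0" using hermitian_characterD(2)[OF \<phi>, of 0 0] by simp
  have "openin (seminorm_topology {p}) {x. \<phi> x \<in> ball 0 1}"
    using openin_continuous_map_preimage[OF cont, of "ball 0 1"]
    by (simp add: topspace_seminorm_topology)
  then obtain F e where F: "F \<subseteq> {p}" "0 < e"
    "{y. \<forall>q\<in>F. q (y - 0) < e} \<subseteq> {x. \<phi> x \<in> ball 0 1}"
    by (rule openin_seminorm_topologyE[of "{p}" _ 0, rotated]) (simp_all add: p \<phi>0)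
  have lt: "cmod (\<phi> y) < 1" if "p y < e" for y
  proof -
    have "y \<in> {y. \<forall>q\<in>F. q (y - 0) < e}" using F(1) that by auto
    then show ?thesis using F(3) by auto
  qed
  have "cmod (\<phi> x) \<le> p x" for x
  proof (rule ccontr)
    assume "\<not> cmod (\<phi> x) \<le> p x"
    then have gt: "p x < cmod (\<phi> x)" by simp
    then have pos: "cmod (\<phi> x) > 0" using seminorm_nonneg[OF p, of x] by linarith
    define z where "z = scaleC (1 / \<phi> x) x"
    have z: "\<phi> z = 1" "p z < 1"
      using gt pos by (auto simp: z_def hermitian_characterD[OF \<phi>] seminorm_scale[OF p] norm_divide)
    obtain n where "p z ^ n < e"
      using real_arch_pow_inv[OF F(2) z(2)] by blast
    then have "p (z ^ n) < e" using seminorm_power_le[OF p, of z n] by linarith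
    then show False
      using lt[of "z ^ n"] z(1) by (simp add: hermitian_characterD[OF \<phi>])
  qed
  then show "\<phi> \<in> bounded_characters p" using \<phi> by (simp add: bounded_characters_def)
next
  fix \<phi> assume "\<phi> \<in> bounded_characters p"
  then show "\<phi> \<in> continuous_characters scaleC star (seminorm_topology {p})"
    by (intro bounded_characters_continuous[of "{p}" p]) (simp_all add: p)
qed

section \<open>Compactness and Stone-Weierstrass approximation\<close>

lemma closed_bounded_characters: "closed (bounded_characters q)"
proof -
  have "bounded_characters q =
    {\<phi>. (\<forall>x y. \<phi> (x + y) = \<phi> x + \<phi> y) \<and> (\<forall>c x. \<phi> (scaleC c x) = c * \<phi> x) \<and>
        (\<forall>x y. \<phi> (x * y) = \<phi> x * \<phi> y) \<and> \<phi> 1 = 1 \<and> (\<forall>x. \<phi> (star x) = cnj (\<phi> x)) \<and>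
        (\<forall>x. cmod (\<phi> x) \<le> q x)}"
    by (auto simp: bounded_characters_def hermitian_characters_def linear_iff_hom)
  moreover have "closed \<dots>"
    by (intro closed_Collect_conj closed_Collect_all closed_Collect_eq closed_Collect_le
        continuous_intros continuous_on_product_coordinates)
  ultimately show ?thesis by simp
qed

text \<open>By Tychonoff's theorem, this is a closed subset of a compact product of discs.\<close>

lemma compact_bounded_characters: "compact (bounded_characters q)"
proof -
  have "compactin (product_topology (\<lambda>_. euclidean) UNIV) (PiE UNIV (\<lambda>x. cball (0::complex) (q x)))"
    by (simp add: compactin_PiE)
  then have "compact (PiE UNIV (\<lambda>x. cball (0::complex) (q x)))"
    by (simp add: euclidean_product_topology)
  moreover have "bounded_characters q \<subseteq> PiE UNIV (\<lambda>x. cball 0 (q x))"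
    by (auto simp: bounded_characters_def)
  ultimately show ?thesis
    by (metis closed_bounded_characters compact_Int_closed inf.absorb_iff2)
qed

text \<open>Characters are real on self-adjoint elements, which thus give a real function algebra on
  \<open>K\<close> to which Stone-Weierstrass applies.\<close>

lemma self_adjoint_approximation:
  assumes K: "compact K" "K \<subseteq> hermitian_characters scaleC star"
    and f: "continuous_on K f" and e: "0 < (e::real)"
  obtains a where "star a = a" "\<And>\<phi>. \<phi> \<in> K \<Longrightarrow> cmod (\<phi> a - of_real (f \<phi>)) < e"
proof -
  define R where "R = {g. \<exists>a. star a = a \<and> (\<forall>\<phi>\<in>K. g \<phi> = Re (\<phi> a))}"
  have RI: "g \<in> R" if "star a = a" "\<And>\<phi>. \<phi> \<in> K \<Longrightarrow> g \<phi> = Re (\<phi> a)" for g a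
    using that by (auto simp: R_def)
  have hc: "\<phi> \<in> hermitian_characters scaleC star" if "\<phi> \<in> K" for \<phi>
    using K(2) that by blast
  note hom = hermitian_characterD[OF hc]
  have "function_ring_on R K"
  proof
    fix g k assume "g \<in> R" "k \<in> R"
    then obtain a b where a: "star a = a" "\<And>\<phi>. \<phi> \<in> K \<Longrightarrow> g \<phi> = Re (\<phi> a)"
      and b: "star b = b" "\<And>\<phi>. \<phi> \<in> K \<Longrightarrow> k \<phi> = Re (\<phi> b)"
      by (auto simp: R_def)
    show "(\<lambda>\<phi>. g \<phi> + k \<phi>) \<in> R"
      by (rule RI[of "a + b"]) (simp_all add: star_add a b hom)
    show "(\<lambda>\<phi>. g \<phi> * k \<phi>) \<in> R"
    proof (rule RI[of "a * b"])
      show "star (a * b) = a * b" by (simp add: star_mult a b mult.commute)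
      fix \<phi> assume "\<phi> \<in> K"
      then show "g \<phi> * k \<phi> = Re (\<phi> (a * b))"
        using self_adjoint_character_real[OF hc a(1)] self_adjoint_character_real[OF hc b(1)]
        by (metis Re_complex_of_real a(2) b(2) hom(4) of_real_mult)
    qed
  next
    fix g assume "g \<in> R"
    then obtain a where "\<And>\<phi>. \<phi> \<in> K \<Longrightarrow> g \<phi> = Re (\<phi> a)" by (auto simp: R_def)
    moreover have "continuous_on K (\<lambda>\<phi>. Re (\<phi> a))"
      by (intro continuous_intros continuous_on_subset[OF continuous_on_product_coordinates]) simp
    ultimately show "continuous_on K g"
      by (subst continuous_on_cong) auto
  next
    fix c show "(\<lambda>_. c) \<in> R"
      by (rule RI[of "scaleC (of_real c) 1"]) (simp_all add: star_scaleC star_one hom)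
  next
    fix \<phi> \<psi> assume \<phi>: "\<phi> \<in> K" and \<psi>: "\<psi> \<in> K" and "\<phi> \<noteq> \<psi>"
    then obtain x where ne: "\<phi> x \<noteq> \<psi> x" by auto
    \<comment> \<open>The self-adjoint elements \<open>x + star x\<close> and
      \<open>scaleC \<i> (star x - x)\<close> take twice the real and the imaginary part of \<phi> x
      as values.\<close>
    show "\<exists>g\<in>R. g \<phi> \<noteq> g \<psi>"
    proof (cases "Re (\<phi> x) = Re (\<psi> x)")
      case False
      then show ?thesis using \<phi> \<psi>
        by (intro bexI[of _ "\<lambda>\<phi>. Re (\<phi> (x + star x))"] RI[of "x + star x"])
          (auto simp: star_add star_star add.commute hom)
    next
      case True
      then have "Im (\<phi> x) \<noteq> Im (\<psi> x)" using ne by (auto simp: complex_eq_iff)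
      then show ?thesis using \<phi> \<psi>
        by (intro bexI[of _ "\<lambda>\<phi>. Re (\<phi> (scaleC \<i> (star x - x)))"] RI[of "scaleC \<i> (star x - x)"])
          (auto simp: star_diff star_scaleC star_star scale_right_diff_distrib hom)
    qed
  qed (rule K(1))
  from function_ring_on.Stone_Weierstrass_basic[OF this f e] obtain a
    where a: "star a = a" "\<And>\<phi>. \<phi> \<in> K \<Longrightarrow> \<bar>f \<phi> - Re (\<phi> a)\<bar> < e"
    unfolding R_def by force
  have "cmod (\<phi> a - of_real (f \<phi>)) < e" if "\<phi> \<in> K" for \<phi>
  proof -
    have "\<phi> a - of_real (f \<phi>) = of_real (Re (\<phi> a) - f \<phi>)"
      using self_adjoint_character_real[OF hc[OF that] a(1)] by simp
    then have "cmod (\<phi> a - of_real (f \<phi>)) = \<bar>Re (\<phi> a) - f \<phi>\<bar>"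
      by (metis norm_of_real)
    then show ?thesis using a(2)[OF that] by (simp add: abs_minus_commute)
  qed
  with a(1) show thesis by (rule that)
qed

section \<open>From lower semicontinuity to a supremum over continuous characters\<close>

lemma lower_semicontinuous_bound:
  assumes P: "\<forall>q\<in>P. C_star_seminorm scaleC star q"
    and p: "C_star_seminorm scaleC star p"
    and lsc: "lower_semicontinuous_map (seminorm_topology P) p"
    and c: "0 \<le> c"
    and bound: "\<And>\<phi>. \<phi> \<in> bounded_characters p \<Longrightarrow>
      \<phi> \<in> continuous_characters scaleC star (seminorm_topology P) \<Longrightarrow> cmod (\<phi> x) \<le> c"
  shows "p x \<le> c"
proof (rule ccontr)
  assume "\<not> p x \<le> c"
  then have cx: "c\<^sup>2 < (p x)\<^sup>2" using c by (intro power_strict_mono) auto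
  define h where "h = x * star x"
  have ph: "p h = (p x)\<^sup>2" by (simp add: h_def seminorm_mult_star[OF p])
  have \<phi>h: "\<phi> h = of_real ((cmod (\<phi> x))\<^sup>2)" if "\<phi> \<in> bounded_characters q" for \<phi> q
    unfolding h_def by (rule hermitian_characterD[OF bounded_charactersD(1)[OF that]])
  define t where "t = (c\<^sup>2 + (p x)\<^sup>2) / 2"
  have t: "c\<^sup>2 < t" "t < p h" using cx by (simp_all add: t_def ph)
  then have t0: "0 < t" using zero_le_power2[of c] by linarith
  have "openin (seminorm_topology P) {y. t < p y}"
    using lsc by (simp add: lower_semicontinuous_map_def topspace_seminorm_topology)
  then obtain F e where F: "finite F" "F \<subseteq> P" "0 < e" "{y. \<forall>q\<in>F. q (y - h) < e} \<subseteq> {y. t < p y}"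
    using openin_seminorm_topologyE[OF P, of "{y. t < p y}" h] t(2) by blast
  define Y where "Y = (\<Union>q\<in>F. bounded_characters q)"
  define f where "f \<phi> = (if \<phi> \<in> Y then Re (\<phi> h) else min (Re (\<phi> h)) (c\<^sup>2))" for \<phi> :: "'a \<Rightarrow> complex"
  define K where "K = Y \<union> bounded_characters p"
  \<comment> \<open>Characters in \<open>Y\<close> are continuous for the topology of
    \<open>P\<close>, so \<open>bound\<close> applies to them: the two branches of \<open>f\<close>
    agree where they meet, and \<open>f\<close> is at most \<open>c\<^sup>2\<close> on
    \<open>bounded_characters p\<close>.\<close>
  have le_c: "Re (\<phi> h) \<le> c\<^sup>2" if "\<phi> \<in> bounded_characters p" "\<phi> \<in> Y" for \<phi>
  proof -
    have "\<phi> \<in> continuous_characters scaleC star (seminorm_topology P)"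
      using that(2) F(2) bounded_characters_continuous[OF P] by (auto simp: Y_def)
    then show ?thesis
      using bound[OF that(1)] by (simp add: \<phi>h[OF that(1)] power_mono)
  qed
  have contRe: "continuous_on S (\<lambda>\<phi>. Re (\<phi> h))" for S :: "('a \<Rightarrow> complex) set"
    by (intro continuous_intros continuous_on_subset[OF continuous_on_product_coordinates]) simp
  have f: "continuous_on K f"
    unfolding K_def f_def
  proof (rule continuous_on_If)
    show "closed Y" unfolding Y_def using F(1) by (intro closed_UN) (simp_all add: closed_bounded_characters)
    show "continuous_on (bounded_characters p) (\<lambda>\<phi>. min (Re (\<phi> h)) (c\<^sup>2))"
      by (intro continuous_on_min contRe continuous_on_const)
  qed (use closed_bounded_characters contRe le_c in auto)
  have "compact K"
    unfolding K_def Y_def using F(1) by (intro compact_Un compact_UN) (simp_all add: compact_bounded_characters)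
  moreover have "K \<subseteq> hermitian_characters scaleC star"
    by (auto simp: K_def Y_def bounded_characters_def)
  moreover note f
  \<comment> \<open>Tolerance \<open>e\<close> keeps \<open>a\<close> in the chosen neighbourhood of
    \<open>h\<close>, while \<open>t - c\<^sup>2\<close> forces \<open>p a\<close> to be at most
    \<open>t\<close>.\<close>
  ultimately obtain a where a: "\<And>\<phi>. \<phi> \<in> K \<Longrightarrow> cmod (\<phi> a - of_real (f \<phi>)) < min e (t - c\<^sup>2)"
    by (rule self_adjoint_approximation[of K f "min e (t - c\<^sup>2)"]) (use F(3) t(1) in auto)
  \<comment> \<open>A nonzero value \<open>q (a - h)\<close> is attained by a character in
    \<open>Y\<close>, where \<open>f\<close> is the untruncated \<phi> h.\<close>
  have "q (a - h) < e" if "q \<in> F" for q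
  proof (cases "q (a - h) = 0")
    case False
    have q: "C_star_seminorm scaleC star q" using that F(2) P by blast
    then obtain \<phi> where \<phi>: "\<phi> \<in> bounded_characters q" "cmod (\<phi> (a - h)) = q (a - h)"
      using attained_by_character[OF q, of "a - h"] seminorm_nonneg[OF q, of "a - h"] False by force
    then have "\<phi> \<in> Y" using that by (auto simp: Y_def)
    then show ?thesis
      using a[of \<phi>] \<phi> \<phi>h[OF \<phi>(1)]
      by (simp add: K_def f_def hermitian_characterD[OF bounded_charactersD(1)[OF \<phi>(1)]])
  qed (use F in simp)
  then have pa: "t < p a" using F(4) by blast
  then have "0 < p a" using t0 by simp
  then obtain \<phi> where \<phi>: "\<phi> \<in> bounded_characters p" "cmod (\<phi> a) = p a"
    using attained_by_character[OF p] by blast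
  have "cmod (\<phi> a - of_real (f \<phi>)) < t - c\<^sup>2"
    using a[of \<phi>] \<phi>(1) by (simp add: K_def)
  moreover have "0 \<le> f \<phi>" "f \<phi> \<le> c\<^sup>2"
    using le_c[OF \<phi>(1)] by (auto simp: f_def \<phi>h[OF \<phi>(1)])
  ultimately show False
    using norm_triangle_ineq2[of "\<phi> a" "of_real (f \<phi>)"] \<phi>(2) pa by simp
qed

section \<open>Domination by a set of characters and its closure\<close>

text \<open>If a basic neighbourhood of \<psi> misses \<open>S\<close>, a sum \<open>y\<close> of
  elements \<open>d i * star (d i)\<close> vanishes at \<psi> and is at least
  \<open>e\<^sup>2\<close> on \<open>S\<close>. Then \<open>M - y\<close> peaks at \<psi> and
  violates domination.\<close>

lemma dominated_character_in_closure:
  assumes p: "C_star_seminorm scaleC star p" and S: "S \<subseteq> bounded_characters p"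
    and dom: "\<And>c x. 0 \<le> c \<Longrightarrow> (\<And>\<phi>. \<phi> \<in> S \<Longrightarrow> cmod (\<phi> x) \<le> c) \<Longrightarrow> p x \<le> c"
    and \<psi>: "\<psi> \<in> bounded_characters p"
  shows "\<psi> \<in> closure S"
proof (rule ccontr)
  assume "\<psi> \<notin> closure S"
  then have "open (- closure S)" "\<psi> \<in> - closure S" by auto
  then obtain X where X: "\<psi> \<in> PiE UNIV X" "\<And>i. open (X i)" "finite {i. X i \<noteq> UNIV}"
    "PiE UNIV X \<subseteq> - closure S"
    using product_topology_open_contains_basis[of "\<lambda>_. euclidean" UNIV "- closure S" \<psi>]
    by (auto simp: open_fun_def)
  define J where "J = {i. X i \<noteq> UNIV}"
  have "\<exists>e>0. \<forall>z. dist z (\<psi> i) < e \<longrightarrow> z \<in> X i" for i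
    using X(1,2) by (auto simp: open_dist PiE_iff)
  then obtain r where r: "\<And>i. 0 < r i" "\<And>i z. dist z (\<psi> i) < r i \<Longrightarrow> z \<in> X i"
    by metis
  \<comment> \<open>The inserted 1 keeps the minimum meaningful when \<open>J\<close> is
    empty.\<close>
  define e where "e = Min (insert 1 (r ` J))"
  have J: "finite J" using X(3) by (simp add: J_def)
  have e: "0 < e" "\<And>i. i \<in> J \<Longrightarrow> e \<le> r i"
    using r(1) J by (auto simp: e_def Min_gr_iff)
  define d where "d i = i - scaleC (\<psi> i) 1" for i
  define y where "y = (\<Sum>i\<in>J. d i * star (d i))"
  have hom_sum: "\<phi> y = of_real (\<Sum>i\<in>J. (cmod (\<phi> i - \<psi> i))\<^sup>2)"
    if "\<phi> \<in> hermitian_characters scaleC star" for \<phi>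
  proof -
    note hom = hermitian_characterD[OF that]
    have "\<phi> 0 = 0" using hom(2)[of 0 0] by simp
    have "\<phi> (\<Sum>i\<in>J. g i) = (\<Sum>i\<in>J. \<phi> (g i))" for g
      using J by (induction J rule: finite_induct) (simp_all add: hom(1) \<open>\<phi> 0 = 0\<close>)
    then have "\<phi> y = (\<Sum>i\<in>J. \<phi> (d i * star (d i)))"
      by (simp add: y_def)
    also have "\<dots> = (\<Sum>i\<in>J. of_real ((cmod (\<phi> (d i)))\<^sup>2))"
      by (simp only: hom(8))
    finally show ?thesis by (simp add: d_def hom(2,3,5))
  qed
  \<comment> \<open>The term \<open>p y\<close> keeps M - \<phi> y nonnegative, so its modulus is
    its value; adding \<open>e\<^sup>2\<close> makes the bound \<open>M - e\<^sup>2\<close>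
    nonnegative, as \<open>dom\<close> requires.\<close>
  define M where "M = p y + e\<^sup>2"
  have M: "e\<^sup>2 \<le> M" using seminorm_nonneg[OF p] by (simp add: M_def)
  define z where "z = scaleC (of_real M) 1 - y"
  have \<phi>z: "\<phi> z = of_real (M - (\<Sum>i\<in>J. (cmod (\<phi> i - \<psi> i))\<^sup>2))"
    if "\<phi> \<in> hermitian_characters scaleC star" for \<phi>
    using hom_sum[OF that] by (simp add: z_def hermitian_characterD(2,3,5)[OF that])
  have "cmod (\<phi> z) \<le> M - e\<^sup>2" if "\<phi> \<in> S" for \<phi>
  proof -
    have \<phi>: "\<phi> \<in> bounded_characters p" using S that by blast
    have "\<phi> \<notin> PiE UNIV X" using X(4) that closure_subset by blast
    then obtain i where i: "\<phi> i \<notin> X i" by auto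
    then have "i \<in> J" by (auto simp: J_def)
    have "e \<le> cmod (\<phi> i - \<psi> i)"
      using r(2)[of "\<phi> i" i] i e(2)[OF \<open>i \<in> J\<close>] by (force simp: dist_norm)
    then have "e\<^sup>2 \<le> (cmod (\<phi> i - \<psi> i))\<^sup>2" using e by (intro power_mono) auto
    also have "\<dots> \<le> (\<Sum>i\<in>J. (cmod (\<phi> i - \<psi> i))\<^sup>2)"
      using J \<open>i \<in> J\<close> by (intro member_le_sum) auto
    finally have lower: "e\<^sup>2 \<le> (\<Sum>i\<in>J. (cmod (\<phi> i - \<psi> i))\<^sup>2)" .
    have "(\<Sum>i\<in>J. (cmod (\<phi> i - \<psi> i))\<^sup>2) = cmod (\<phi> y)"
      unfolding hom_sum[OF bounded_charactersD(1)[OF \<phi>]] norm_of_real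
      by (simp add: sum_nonneg)
    also have "\<dots> \<le> M" using bounded_charactersD(2)[OF \<phi>, of y] by (simp add: M_def add_increasing2)
    finally show ?thesis
      using lower unfolding \<phi>z[OF bounded_charactersD(1)[OF \<phi>]] norm_of_real by simp
  qed
  then have "p z \<le> M - e\<^sup>2" using M by (intro dom) auto
  moreover have "M \<le> p z"
    using bounded_charactersD(2)[OF \<psi>, of z] M
    by (simp add: \<phi>z[OF bounded_charactersD(1)[OF \<psi>]])
  moreover have "0 < e\<^sup>2" using e(1) by simp
  ultimately show False by linarith
qed

section \<open>From density to lower semicontinuity, and the final equivalence\<close>

text \<open>A character attaining \<open>p x > t\<close> can be moved into \<open>S\<close> by
  density, since exceeding \<open>t\<close> in modulus at \<open>x\<close> is an open condition. So
  the set where \<open>p\<close> exceeds \<open>t\<close> is a union of open sets.\<close>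

lemma dense_imp_lower_semicontinuous:
  assumes p: "C_star_seminorm scaleC star p" and univ: "topspace T = UNIV"
    and S: "S \<subseteq> bounded_characters p \<inter> continuous_characters scaleC star T"
    and dense: "bounded_characters p \<subseteq> closure S"
  shows "lower_semicontinuous_map T p"
  unfolding lower_semicontinuous_map_def
proof
  fix t
  show "openin T {x \<in> topspace T. t < p x}"
  \<comment> \<open>For nonnegative \<open>t\<close>, the inequality \<open>t < p x\<close> makes
    \<open>p x\<close> positive, as \<open>attained_by_character\<close> requires.\<close>
  proof (cases "t < 0")
    case True
    then have "{x \<in> topspace T. t < p x} = topspace T"
      using seminorm_nonneg[OF p] by (auto intro: less_le_trans)
    then show ?thesis by simp
  next
    case False
    have "{x \<in> topspace T. t < p x} = (\<Union>\<phi>\<in>S. {x \<in> topspace T. \<phi> x \<in> {z. t < cmod z}})"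
    proof (intro equalityI subsetI)
      fix x assume "x \<in> {x \<in> topspace T. t < p x}"
      then have x: "t < p x" by simp
      then obtain \<phi> where \<phi>: "\<phi> \<in> bounded_characters p" "cmod (\<phi> x) = p x"
        using attained_by_character[OF p, of x] False by force
      have "open ((\<lambda>\<phi>. \<phi> x) -` {z::complex. t < cmod z})"
        by (intro open_vimage_apply open_Collect_less continuous_intros)
      moreover have "\<phi> \<in> (\<lambda>\<phi>. \<phi> x) -` {z. t < cmod z} \<inter> closure S"
        using \<phi> x dense by auto
      ultimately have "(\<lambda>\<phi>. \<phi> x) -` {z. t < cmod z} \<inter> S \<noteq> {}"
        using open_Int_closure_eq_empty by blast
      then show "x \<in> (\<Union>\<phi>\<in>S. {x \<in> topspace T. \<phi> x \<in> {z. t < cmod z}})"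
        using univ by auto
    next
      fix x assume "x \<in> (\<Union>\<phi>\<in>S. {x \<in> topspace T. \<phi> x \<in> {z. t < cmod z}})"
      then show "x \<in> {x \<in> topspace T. t < p x}"
        using S bounded_charactersD(2) univ by (fastforce intro: less_le_trans)
    qed
    moreover have "openin T {x \<in> topspace T. \<phi> x \<in> {z. t < cmod z}}" if "\<phi> \<in> S" for \<phi>
      using S that unfolding continuous_characters_def
      by (intro openin_continuous_map_preimage[of T euclidean])
        (auto intro!: open_Collect_less continuous_intros)
    ultimately show ?thesis by (auto intro!: openin_Union)
  qed
qed

text \<open>As \<open>bounded_characters p\<close> is closed in the space of all functions, the
  closure of \<open>S\<close> there already consists of hermitian characters.\<close>

lemma character_space_closure:
  assumes "S \<subseteq> bounded_characters p"
  shows "character_space scaleC star closure_of S = closure S"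
proof -
  have "closure S \<subseteq> bounded_characters p"
    using assms closed_bounded_characters by (rule closure_minimal)
  then have "closure S \<subseteq> hermitian_characters scaleC star" "S \<subseteq> hermitian_characters scaleC star"
    using assms by (auto simp: bounded_characters_def)
  then show ?thesis
    by (simp add: character_space_def euclidean_product_topology closure_of_subtopology
        inf.absorb2)
qed

end

theorem theorem3p1:
  fixes scaleC :: "complex \<Rightarrow> 'a::{comm_ring, comm_monoid_mult} \<Rightarrow> 'a"
    and star :: "'a \<Rightarrow> 'a"
    and T :: "'a topology"
    and p :: "'a \<Rightarrow> real"
  assumes "LC_star_algebra scaleC star T"
    and "C_star_seminorm scaleC star p"
  shows "lower_semicontinuous_map T p \<longleftrightarrow>
    continuous_characters scaleC star (seminorm_topology {p}) =
      character_space scaleC star closure_of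
        (continuous_characters scaleC star (seminorm_topology {p}) \<inter>
         continuous_characters scaleC star T)"
proof -
  interpret LC_star_algebra scaleC star T by fact
  obtain P where P: "\<forall>q\<in>P. C_star_seminorm scaleC star q" and T: "T = seminorm_topology P"
    using topology_from_seminorms by blast
  define S where "S = bounded_characters p \<inter> continuous_characters scaleC star T"
  have S: "S \<subseteq> bounded_characters p" by (simp add: S_def)
  have "lower_semicontinuous_map T p \<longleftrightarrow> bounded_characters p = closure S"
  proof
    assume lsc: "lower_semicontinuous_map T p"
    have "p x \<le> c" if "0 \<le> c" "\<And>\<phi>. \<phi> \<in> S \<Longrightarrow> cmod (\<phi> x) \<le> c" for c x
      using lower_semicontinuous_bound[OF P assms(2) lsc[unfolded T] that(1), of x] that(2)
      by (simp add: S_def T)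
    then show "bounded_characters p = closure S"
      using dominated_character_in_closure[OF assms(2) S]
        closure_minimal[OF S closed_bounded_characters] by blast
  next
    assume "bounded_characters p = closure S"
    then show "lower_semicontinuous_map T p"
      by (intro dense_imp_lower_semicontinuous[OF assms(2), of T S])
        (simp_all add: T topspace_seminorm_topology S_def)
  qed
  then show ?thesis
    by (simp add: continuous_characters_singleton[OF assms(2)] character_space_closure[OF S] flip: S_def)
qed

end
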